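(* Let $Q=(\triangle_{A_{2n-1}},\xi)$ be a Dynkin quiver of type $A_{2n-1}$ with $\xi_i=\xi_{2n-i}$ for all $i$ (i.e. $\vee$-fixed), let $\overline Q=(\triangle_{C_n},\overline\xi)$ be the Dynkin quiver of type $C_n$ with $\overline\xi_i=\xi_i$ for $1\le i\le n$, and let $k\in\mathbb Z$. Then for $1\le i\le n$, $$\psi\bigl(\tau_Q^k(\gamma_i^Q)\bigr)=\psi\bigl(\tau_Q^k(\gamma_{2n-i}^Q)\bigr)=\tau_{\overline Q}^k(\gamma_i^{\overline Q}).$$
   Context: For a finite Dynkin diagram $\triangle$ with vertex set $I$ and fundamental weights $\varpi_i$, a Dynkin quiver $Q=(\triangle,\xi)$ is given by a height function $\xi:I\to\mathbb Z$ with $|\xi_i-\xi_j|=1$ for adjacent $i,j$. $i$ is a source if $\xi_i>\xi_j$ for all neighbours $j$; then $s_iQ=(\triangle,s_i\xi)$, $(s_i\xi)_j=\xi_j-2\delta_{i,j}$. A reduced expression $s_{i_1}\cdots s_{i_l}$ in the Weyl group is $Q$-adapted if $i_k$ is a source of $s_{i_{k-1}}\cdots s_{i_1}Q$ for all $k$. $\tau_Q$ is the unique Coxeter element all of whose reduced expressions are $Q$-adapted; $\gamma_i^Q=(1-\tau_Q)\varpi_i\in\Phi^+$. Type $A_{2n-1}$: nodes $1,\dots,2n-1$ in a chain; $\vee(i)=2n-i$. Type $C_n$: nodes $1,\dots,n$ in a chain, $\alpha_n$ the long simple root. $\psi$ is the linear map from the root lattice of $A_{2n-1}$ to that of $C_n$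 with $\psi(\alpha_i)=\psi(\alpha_{2n-i})=\alpha_i$ for $1\le i\le n$; it restricts to a surjection $\Phi^+_{A_{2n-1}}\to\Phi^+_{C_n}$. *)

theory Defs
  imports Complex_Main
begin

text \<open>Cartan matrices follow the convention \<open>cartan D i j = \<langle>h\<^sub>i, \<alpha>\<^sub>j\<rangle>\<close>, so that
  \<open>s\<^sub>i \<alpha>\<^sub>j = \<alpha>\<^sub>j - cartan D i j \<cdot> \<alpha>\<^sub>i\<close>.\<close>

record dynkin =
  verts :: "nat set"
  cartan :: "nat \<Rightarrow> nat \<Rightarrow> int"

definition type_A :: "nat \<Rightarrow> dynkin" where
  "type_A m = \<lparr>verts = {1..m},
     cartan = (\<lambda>i j. if i = j then 2 else if j = Suc i \<or> i = Suc j then -1 else 0)\<rparr>"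

text \<open>The simple root \<open>\<alpha>\<^sub>n\<close> is long: \<open>\<langle>h\<^bsub>n-1\<^esub>, \<alpha>\<^sub>n\<rangle> = -2\<close> and \<open>\<langle>h\<^sub>n, \<alpha>\<^bsub>n-1\<^esub>\<rangle> = -1\<close>.\<close>

definition type_C :: "nat \<Rightarrow> dynkin" where
  "type_C n = \<lparr>verts = {1..n},
     cartan = (\<lambda>i j. if i = j then 2
                     else if j = Suc i then (if j = n then -2 else -1)
                     else if i = Suc j then -1 else 0)\<rparr>"

definition adjacent :: "dynkin \<Rightarrow> nat \<Rightarrow> nat \<Rightarrow> bool" where
  "adjacent D i j \<longleftrightarrow> i \<in> verts D \<and> j \<in> verts D \<and> i \<noteq> j \<and> cartan D i j \<noteq> 0"

text \<open>A function \<open>v\<close> vanishing outside \<open>verts D\<close> stands for \<open>\<Sum>\<^sub>j v\<^sub>j \<alpha>\<^sub>j\<close>. Coefficients are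
  rational because the fundamental weights lie in the rational span of the root lattice.\<close>

type_synonym vec = "nat \<Rightarrow> rat"

definition root_space :: "dynkin \<Rightarrow> vec set" where
  "root_space D = {v. \<forall>j. j \<notin> verts D \<longrightarrow> v j = 0}"

definition simple_root :: "nat \<Rightarrow> vec" where
  "simple_root i = (\<lambda>j. if j = i then 1 else 0)"

definition coroot_pairing :: "dynkin \<Rightarrow> nat \<Rightarrow> vec \<Rightarrow> rat" where
  "coroot_pairing D i v = (\<Sum>j\<in>verts D. of_int (cartan D i j) * v j)"

definition fund_weight :: "dynkin \<Rightarrow> nat \<Rightarrow> vec" where
  "fund_weight D i = (THE v. v \<in> root_space D \<and>
     (\<forall>j\<in>verts D. coroot_pairing D j v = (if j = i then 1 else 0)))"

definition reflection :: "dynkin \<Rightarrow> nat \<Rightarrow> vec \<Rightarrow> vec" where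
  "reflection D i v = (\<lambda>j. v j - coroot_pairing D i v * simple_root i j)"

text \<open>Weyl group elements are maps on all of \<open>vec\<close>; the coordinates outside \<open>verts D\<close> are
  neither read nor changed, so this is the same group as the one acting on \<open>root_space D\<close>.\<close>

definition weyl_word :: "dynkin \<Rightarrow> nat list \<Rightarrow> vec \<Rightarrow> vec" where
  "weyl_word D w = foldr (\<lambda>i f. reflection D i \<circ> f) w id"

definition reduced_word :: "dynkin \<Rightarrow> nat list \<Rightarrow> bool" where
  "reduced_word D w \<longleftrightarrow> set w \<subseteq> verts D \<and>
     (\<forall>u. set u \<subseteq> verts D \<and> weyl_word D u = weyl_word D w \<longrightarrow> length w \<le> length u)"

definition coxeter_element :: "dynkin \<Rightarrow> (vec \<Rightarrow> vec) \<Rightarrow> bool" where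
  "coxeter_element D x \<longleftrightarrow> (\<exists>w. distinct w \<and> set w = verts D \<and> x = weyl_word D w)"

record quiver =
  diagram :: dynkin
  height :: "nat \<Rightarrow> int"

definition dynkin_quiver :: "quiver \<Rightarrow> bool" where
  "dynkin_quiver Q \<longleftrightarrow>
     (\<forall>i j. adjacent (diagram Q) i j \<longrightarrow> \<bar>height Q i - height Q j\<bar> = 1)"

definition is_source :: "quiver \<Rightarrow> nat \<Rightarrow> bool" where
  "is_source Q i \<longleftrightarrow> i \<in> verts (diagram Q) \<and>
     (\<forall>j. adjacent (diagram Q) i j \<longrightarrow> height Q i > height Q j)"

definition reflect_quiver :: "nat \<Rightarrow> quiver \<Rightarrow> quiver" where
  "reflect_quiver i Q = Q\<lparr>height := (height Q)(i := height Q i - 2)\<rparr>"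

text \<open>\<open>fold reflect_quiver [i\<^sub>1, \<dots>, i\<^sub>k] Q\<close> is \<open>s\<^bsub>i\<^sub>k\<^esub> \<cdots> s\<^bsub>i\<^sub>1\<^esub> Q\<close>.\<close>

definition adapted :: "quiver \<Rightarrow> nat list \<Rightarrow> bool" where
  "adapted Q w \<longleftrightarrow>
     (\<forall>k < length w. is_source (fold reflect_quiver (take k w) Q) (w ! k))"

definition tau :: "quiver \<Rightarrow> vec \<Rightarrow> vec" where
  "tau Q = (THE x. coxeter_element (diagram Q) x \<and>
     (\<forall>w. reduced_word (diagram Q) w \<and> weyl_word (diagram Q) w = x \<longrightarrow> adapted Q w))"

definition gamma :: "quiver \<Rightarrow> nat \<Rightarrow> vec" where
  "gamma Q i = (\<lambda>j. fund_weight (diagram Q) i j - tau Q (fund_weight (diagram Q) i) j)"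

definition int_iterate :: "('a \<Rightarrow> 'a) \<Rightarrow> int \<Rightarrow> 'a \<Rightarrow> 'a" where
  "int_iterate f k = (if k \<ge> 0 then f ^^ nat k else inv f ^^ nat (- k))"

definition fold_vertex :: "nat \<Rightarrow> nat \<Rightarrow> nat" where
  "fold_vertex n j = (if j \<le> n then j else 2 * n - j)"

text \<open>The rational-linear extension of the map of root lattices \<open>A\<^bsub>2n-1\<^esub> \<rightarrow> C\<^sub>n\<close>,
  \<open>\<psi> (\<Sum>\<^sub>j v\<^sub>j \<alpha>\<^sub>j) = \<Sum>\<^sub>j v\<^sub>j \<psi>(\<alpha>\<^sub>j)\<close>.\<close>

definition psi :: "nat \<Rightarrow> vec \<Rightarrow> vec" where
  "psi n v = (\<lambda>i. \<Sum>j\<in>{1..2 * n - 1}. v j * simple_root (fold_vertex n j) i)"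

lemma psi_simple_root_aux:
  assumes "j \<in> {1..2 * n - 1}"
  shows "psi n (simple_root j) = simple_root (fold_vertex n j)"
proof
  fix i
  have "psi n (simple_root j) i =
      (\<Sum>l\<in>{1..2 * n - 1}. if l = j then simple_root (fold_vertex n l) i else 0)"
    unfolding psi_def by (rule sum.cong) (auto simp: simple_root_def)
  then show "psi n (simple_root j) i = simple_root (fold_vertex n j) i"
    using assms by simp
qed

lemma psi_simple_root:
  assumes "1 \<le> i" "i \<le> n"
  shows "psi n (simple_root i) = simple_root i"
    and "psi n (simple_root (2 * n - i)) = simple_root i"
proof -
  have "i \<in> {1..2 * n - 1}" "2 * n - i \<in> {1..2 * n - 1}"
    using assms by auto
  moreover have "fold_vertex n i = i" "fold_vertex n (2 * n - i) = i"
    using assms by (auto simp: fold_vertex_def)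
  ultimately show "psi n (simple_root i) = simple_root i"
    and "psi n (simple_root (2 * n - i)) = simple_root i"
    using psi_simple_root_aux by metis+
qed

end

theory Submission
  imports Defs
begin

text \<open>For a word \<open>w\<close> using each vertex once and \<open>c = v - weyl_word D w v\<close>, the reflections can
  be read off row by row: \<open>\<langle>h\<^sub>k, v\<rangle> = c\<^sub>k + \<Sum>\<^sub>l cartan D k l \<cdot> c\<^sub>l\<close>, where \<open>l\<close> runs over the letters
  following \<open>k\<close>. For an adapted word these rows depend on \<open>Q\<close> alone and form a triangular system,
  so all adapted words give the same element; since the pairings \<open>\<langle>h\<^sub>k, v\<rangle>\<close> can be prescribed, the
  element conversely determines the order of adjacent letters. Hence \<open>tau Q\<close> is the product of all
  simple reflections in order of decreasing height. For a symmetric height function the vertices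
  \<open>j\<close> and \<open>2n-j\<close> may be placed next to each other, and \<open>\<psi>\<close> intertwines
  \<open>s\<^sub>j s\<^bsub>2n-j\<^esub>\<close> with \<open>s\<^sub>j\<close> and maps fundamental weights to fundamental weights.\<close>

section \<open>Words in simple reflections\<close>

lemma weyl_word_Nil [simp]: "weyl_word D [] v = v"
  by (simp add: weyl_word_def)

lemma weyl_word_Cons [simp]: "weyl_word D (i # w) v = reflection D i (weyl_word D w v)"
  by (simp add: weyl_word_def)

lemma weyl_word_append: "weyl_word D (u @ w) v = weyl_word D u (weyl_word D w v)"
  by (induction u) auto

lemma reflection_other: "j \<noteq> i \<Longrightarrow> reflection D i v j = v j"
  by (simp add: reflection_def simple_root_def)

lemma reflection_same: "reflection D i v i = v i - coroot_pairing D i v"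
  by (simp add: reflection_def simple_root_def)

lemma weyl_word_notin: "j \<notin> set w \<Longrightarrow> weyl_word D w v j = v j"
  by (induction w) (auto simp: reflection_other)

lemma coroot_pairing_diff:
  "coroot_pairing D i (\<lambda>j. u j - v j) = coroot_pairing D i u - coroot_pairing D i v"
  by (simp add: coroot_pairing_def algebra_simps sum_subtractf)

lemma coroot_pairing_scale:
  "coroot_pairing D i (\<lambda>j. c * v j) = c * coroot_pairing D i v"
  by (simp add: coroot_pairing_def algebra_simps sum_distrib_left)

lemma coroot_pairing_sum:
  "coroot_pairing D i (\<lambda>j. \<Sum>a\<in>A. f a j) = (\<Sum>a\<in>A. coroot_pairing D i (f a))"
  unfolding coroot_pairing_def by (subst sum.swap) (simp add: sum_distrib_left)

text \<open>Encoded by splittings rather than positions; in a distinct word the splitting at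
  \<open>k\<close> is unique, so this is the tail after \<open>k\<close>.\<close>

definition later :: "'a list \<Rightarrow> 'a \<Rightarrow> 'a set" where
  "later w k = {l. \<exists>p s. w = p @ k # s \<and> l \<in> set s}"

lemma later_append_Cons:
  assumes "distinct (p @ k # s)"
  shows "later (p @ k # s) k = set s"
proof -
  have "k \<notin> set p" "k \<notin> set s" using assms by auto
  then have "s' = s" if "p @ k # s = p' @ k # s'" for p' s'
    using append_Cons_eq_iff[of k p s p' s'] that by simp
  then show ?thesis by (auto simp: later_def)
qed

lemma later_subset: "later w k \<subseteq> set w"
  by (auto simp: later_def)

lemma later_sorted_wrt: "sorted_wrt P w \<Longrightarrow> l \<in> later w k \<Longrightarrow> P k l"
  by (auto simp: later_def sorted_wrt_append)

lemma later_total: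
  assumes "k \<in> set w" "l \<in> set w" "k \<noteq> l"
  shows "l \<in> later w k \<or> k \<in> later w l"
proof -
  obtain p s where w: "w = p @ k # s"
    using assms(1) split_list by metis
  show ?thesis
  proof (cases "l \<in> set s")
    case True
    then show ?thesis by (auto simp: later_def w)
  next
    case False
    then have "l \<in> set p" using assms w by auto
    then obtain p1 p2 where "p = p1 @ l # p2" using split_list by metis
    then have "w = p1 @ l # (p2 @ k # s)" using w by simp
    then show ?thesis unfolding later_def by fastforce
  qed
qed

section \<open>Adaptedness as a condition on the order of adjacent letters\<close>

lemma diagram_fold_reflect_quiver [simp]: "diagram (fold reflect_quiver p Q) = diagram Q"
  by (induction p arbitrary: Q) (auto simp: reflect_quiver_def)

lemma height_fold_reflect_quiver:
  "distinct p \<Longrightarrow>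
    height (fold reflect_quiver p Q) j = height Q j - (if j \<in> set p then 2 else 0)"
  by (induction p arbitrary: Q) (auto simp: reflect_quiver_def)

lemma adapted_iff_split:
  "adapted Q w \<longleftrightarrow> (\<forall>p k s. w = p @ k # s \<longrightarrow> is_source (fold reflect_quiver p Q) k)"
proof
  assume *: "adapted Q w"
  show "\<forall>p k s. w = p @ k # s \<longrightarrow> is_source (fold reflect_quiver p Q) k"
  proof (intro allI impI)
    fix p k s assume w: "w = p @ k # s"
    then have "length p < length w" "take (length p) w = p" "w ! length p = k" by auto
    with * show "is_source (fold reflect_quiver p Q) k" unfolding adapted_def by metis
  qed
next
  assume "\<forall>p k s. w = p @ k # s \<longrightarrow> is_source (fold reflect_quiver p Q) k"
  then show "adapted Q w" unfolding adapted_def by (metis id_take_nth_drop)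
qed

text \<open>When the turn of \<open>k\<close> comes, the neighbours already used have dropped by 2.
  Heights of neighbours differ by exactly 1, so these lie below \<open>k\<close> anyway, and only
  the neighbours still to come impose a condition.\<close>

lemma adapted_iff_later:
  assumes Q: "dynkin_quiver Q" and w: "distinct w" "set w = verts (diagram Q)"
  shows "adapted Q w \<longleftrightarrow>
    (\<forall>k. \<forall>l\<in>later w k. adjacent (diagram Q) k l \<longrightarrow> height Q l < height Q k)"
proof -
  have "is_source (fold reflect_quiver p Q) k \<longleftrightarrow>
      (\<forall>l\<in>set s. adjacent (diagram Q) k l \<longrightarrow> height Q l < height Q k)"
    if split: "w = p @ k # s" for p k s
  proof -
    have dist: "distinct p" "k \<notin> set p" "set p \<inter> set s = {}" "k \<notin> set s"
      using w(1) split by auto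
    have k: "k \<in> verts (diagram Q)" and v: "verts (diagram Q) = set p \<union> {k} \<union> set s"
      using w(2) split by auto
    have "height Q j - (if j \<in> set p then 2 else 0) < height Q k \<longleftrightarrow>
        (j \<in> set s \<longrightarrow> height Q j < height Q k)"
      if "adjacent (diagram Q) k j" for j
    proof -
      have "\<bar>height Q k - height Q j\<bar> = 1" "j \<in> set p \<union> set s"
        using that Q v by (auto simp: adjacent_def dynkin_quiver_def)
      then show ?thesis using dist(3) by auto
    qed
    then show ?thesis
      using k dist(2) by (simp add: is_source_def height_fold_reflect_quiver[OF dist(1)] Ball_def) metis
  qed
  then have "adapted Q w \<longleftrightarrow> (\<forall>p k s. w = p @ k # s \<longrightarrow>
      (\<forall>l\<in>set s. adjacent (diagram Q) k l \<longrightarrow> height Q l < height Q k))"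
    unfolding adapted_iff_split by (intro all_cong1 imp_cong refl)
  then show ?thesis
    unfolding later_def by auto
qed

section \<open>Coxeter elements of a diagram of finite type\<close>

text \<open>Finite type enters only through existence and uniqueness of fundamental weights, that
  is, through invertibility of the Cartan matrix. This also makes the definite description in
  \<open>fund_weight\<close> meaningful.\<close>

locale finite_type =
  fixes D :: dynkin
  assumes finite_verts: "finite (verts D)"
    and cartan_diag: "i \<in> verts D \<Longrightarrow> cartan D i i = 2"
    and adjacent_sym: "adjacent D i j \<Longrightarrow> adjacent D j i"
    and ex1_fund_weight: "i \<in> verts D \<Longrightarrow> \<exists>!v. v \<in> root_space D \<and>
      (\<forall>j\<in>verts D. coroot_pairing D j v = (if j = i then 1 else 0))"
begin

lemma fund_weight:
  assumes "i \<in> verts D"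
  shows "fund_weight D i \<in> root_space D"
    and "j \<in> verts D \<Longrightarrow> coroot_pairing D j (fund_weight D i) = (if j = i then 1 else 0)"
  using theI'[OF ex1_fund_weight[OF assms]] unfolding fund_weight_def by blast+

lemma fund_weight_eqI:
  assumes "i \<in> verts D" "v \<in> root_space D"
    and "\<And>j. j \<in> verts D \<Longrightarrow> coroot_pairing D j v = (if j = i then 1 else 0)"
  shows "fund_weight D i = v"
  unfolding fund_weight_def using ex1_fund_weight[OF assms(1)] assms by (intro the1_equality) auto

text \<open>Fundamental weights are dual to the simple coroots, so they serve as a basis for
  prescribing pairings.\<close>

lemma ex_coroot_pairing: "\<exists>v. \<forall>i\<in>verts D. coroot_pairing D i v = b i"
proof (intro exI ballI)
  fix i assume i: "i \<in> verts D"
  have "coroot_pairing D i (\<lambda>j. \<Sum>a\<in>verts D. b a * fund_weight D a j) =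
      (\<Sum>a\<in>verts D. b a * coroot_pairing D i (fund_weight D a))"
    by (simp add: coroot_pairing_sum coroot_pairing_scale)
  also have "\<dots> = (\<Sum>a\<in>verts D. if i = a then b a else 0)"
    by (rule sum.cong) (auto simp: fund_weight(2) i)
  finally show "coroot_pairing D i (\<lambda>j. \<Sum>a\<in>verts D. b a * fund_weight D a j) = b i"
    using i finite_verts by simp
qed

section \<open>Reduced words of Coxeter elements\<close>

lemma coroot_pairing_simple_root:
  "j \<in> verts D \<Longrightarrow> coroot_pairing D i (simple_root j) = of_int (cartan D i j)"
  using finite_verts
  by (simp add: coroot_pairing_def simple_root_def if_distrib cong: if_cong)

lemma reflection_involutive:
  assumes "i \<in> verts D"
  shows "reflection D i (reflection D i v) = v"
proof -
  have "coroot_pairing D i (reflection D i v) = - coroot_pairing D i v"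
    unfolding reflection_def coroot_pairing_diff coroot_pairing_scale
    using assms by (simp add: coroot_pairing_simple_root cartan_diag)
  then show ?thesis
    by (subst (1) reflection_def) (simp add: reflection_def)
qed

lemma bij_weyl_word: "set w \<subseteq> verts D \<Longrightarrow> bij (weyl_word D w)"
proof (induction w)
  case Nil
  have "weyl_word D [] = id" by (simp add: fun_eq_iff)
  then show ?case by (simp only: bij_id)
next
  case (Cons i w)
  have "bij (reflection D i)"
    using Cons.prems by (intro o_bij[of "reflection D i"]) (auto simp: reflection_involutive)
  moreover have "weyl_word D (i # w) = reflection D i \<circ> weyl_word D w" by auto
  ultimately show ?case using Cons by (simp only: bij_comp list.set insert_subset simp_thms)
qed

text \<open>Each letter \<open>k\<close> of a distinct word is detected by a vector whose coordinate
  \<open>k\<close> is moved, which no word avoiding \<open>k\<close> can do.\<close>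

lemma set_subset_of_weyl_word_eq:
  assumes w: "distinct w" "set w \<subseteq> verts D" and eq: "weyl_word D u = weyl_word D w"
  shows "set w \<subseteq> set u"
proof
  fix k assume k: "k \<in> set w"
  then obtain p s where split: "w = p @ k # s" using split_list by metis
  then have dist: "k \<notin> set p" "k \<notin> set s" and s: "set s \<subseteq> verts D" "k \<in> verts D"
    using w by auto
  \<comment> \<open>The letters of \<open>s\<close> act first, so \<open>v\<close> is pulled back to
    reach \<open>k\<close> as its simple root. The reflection at \<open>k\<close> then turns
    coordinate \<open>k\<close> from 1 into -1, and neither \<open>s\<close> nor \<open>p\<close>
    touches that coordinate.\<close>
  obtain v where v: "weyl_word D s v = simple_root k"
    using bij_is_surj[OF bij_weyl_word[OF s(1)]] by (metis surjD)
  have "weyl_word D w v k = - 1"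
    using s(2) dist
    by (simp add: split weyl_word_append weyl_word_notin v reflection_same
        coroot_pairing_simple_root cartan_diag) (simp add: simple_root_def)
  moreover have "v k = 1"
    using weyl_word_notin[OF dist(2), of D v] by (simp add: v simple_root_def)
  ultimately show "k \<in> set u"
    using weyl_word_notin[of k u D v] eq by force
qed

lemma reduced_word_coxeter:
  assumes w: "distinct w" "set w = verts D"
  shows "reduced_word D w"
  unfolding reduced_word_def
proof (intro conjI allI impI)
  fix u assume "set u \<subseteq> verts D \<and> weyl_word D u = weyl_word D w"
  then have "set w \<subseteq> set u" using set_subset_of_weyl_word_eq[of w u] w by auto
  then have "card (set w) \<le> card (set u)" by (intro card_mono) auto
  then show "length w \<le> length u"
    using distinct_card[OF w(1)] card_length[of u] by linarith
qed (use w in auto)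

text \<open>Reduces the quantifier over reduced words in \<open>tau\<close> to words using every
  vertex once: such a word contains all vertices and is no longer than their number.\<close>

lemma coxeter_reduced_word:
  assumes w: "distinct w" "set w = verts D"
    and u: "reduced_word D u" "weyl_word D u = weyl_word D w"
  shows "distinct u" "set u = verts D"
proof -
  show *: "set u = verts D"
    using set_subset_of_weyl_word_eq[of w u] w u by (auto simp: reduced_word_def)
  have "length u \<le> length w"
    using u w by (auto simp: reduced_word_def)
  also have "\<dots> = card (set u)" using * w distinct_card by metis
  finally show "distinct u" using card_length[of u] card_distinct[of u] by linarith
qed

section \<open>The triangular system attached to a word\<close>

lemma coroot_pairing_weyl_word:
  fixes v :: vec
  assumes w: "distinct w" "set w \<subseteq> verts D" and k: "k \<in> set w"
  defines "c \<equiv> \<lambda>l. v l - weyl_word D w v l"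
  shows "coroot_pairing D k v = c k + (\<Sum>l\<in>later w k. of_int (cartan D k l) * c l)"
proof -
  obtain p s where split: "w = p @ k # s" using k split_list by metis
  then have dist: "k \<notin> set p" "k \<notin> set s" "set p \<inter> set s = {}" using w by auto
  \<comment> \<open>This is the vector on which the reflection at \<open>k\<close> acts:
    \<open>c k\<close> is its pairing with the coroot of \<open>k\<close>, and it differs from
    \<open>v\<close> only in coordinates from \<open>s\<close>, which are final by then.\<close>
  define y where "y = weyl_word D s v"
  have wv: "weyl_word D w v = weyl_word D p (reflection D k y)"
    by (simp add: split weyl_word_append y_def)
  have ck: "c k = coroot_pairing D k y"
    using dist by (simp add: c_def wv weyl_word_notin reflection_same) (simp add: y_def weyl_word_notin)
  have cl: "c l = v l - y l" if "l \<in> set s" for l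
  proof -
    have "l \<notin> set p" "l \<noteq> k" using that dist by auto
    then show ?thesis by (simp add: c_def wv weyl_word_notin reflection_other)
  qed
  have "coroot_pairing D k v - coroot_pairing D k y =
      (\<Sum>l\<in>verts D. of_int (cartan D k l) * (v l - y l))"
    by (simp add: coroot_pairing_def sum_subtractf algebra_simps)
  also have "\<dots> = (\<Sum>l\<in>set s. of_int (cartan D k l) * (v l - y l))"
    using w(2) finite_verts by (intro sum.mono_neutral_right) (auto simp: split y_def weyl_word_notin)
  also have "\<dots> = (\<Sum>l\<in>set s. of_int (cartan D k l) * c l)"
    by (intro sum.cong) (auto simp: cl)
  finally show ?thesis
    using ck w(1) by (simp add: split later_append_Cons)
qed

text \<open>For an adapted word these are exactly the later letters with nonzero Cartan entry, so a
  row written with \<open>lower\<close> no longer mentions the word.\<close>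

definition lower :: "(nat \<Rightarrow> int) \<Rightarrow> nat \<Rightarrow> nat set" where
  "lower h k = {l. adjacent D k l \<and> h l < h k}"

lemma lower_subset: "lower h k \<subseteq> verts D"
  by (auto simp: lower_def adjacent_def)

lemma lower_system_unique:
  assumes "\<And>k. k \<in> verts D \<Longrightarrow>
      c k + (\<Sum>l\<in>lower h k. of_int (cartan D k l) * c l) =
      d k + (\<Sum>l\<in>lower h k. of_int (cartan D k l) * (d l :: rat))"
    and "k \<in> verts D"
  shows "c k = d k"
  using assms(2)
\<comment> \<open>The system is unitriangular along increasing height. Counting the vertices below
  turns integer heights into a well-founded measure.\<close>
proof (induction "card {l \<in> verts D. h l < h k}" arbitrary: k rule: less_induct)
  case less
  have "c l = d l" if "l \<in> lower h k" for l
  proof (rule less.hyps)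
    show "l \<in> verts D" using that lower_subset by auto
    have "{m \<in> verts D. h m < h l} \<subset> {m \<in> verts D. h m < h k}"
      using that by (auto simp: lower_def adjacent_def)
    then show "card {m \<in> verts D. h m < h l} < card {m \<in> verts D. h m < h k}"
      using finite_verts by (intro psubset_card_mono) auto
  qed
  then have "(\<Sum>l\<in>lower h k. of_int (cartan D k l) * c l) =
      (\<Sum>l\<in>lower h k. of_int (cartan D k l) * d l)"
    by (intro sum.cong) auto
  then show ?case using assms(1)[OF less.prems] by simp
qed

lemma coroot_pairing_adapted:
  fixes v :: vec
  assumes Q: "dynkin_quiver Q" "diagram Q = D"
    and w: "distinct w" "set w = verts D" "adapted Q w" and k: "k \<in> verts D"
  defines "c \<equiv> \<lambda>l. v l - weyl_word D w v l"
  shows "coroot_pairing D k v = c k + (\<Sum>l\<in>lower (height Q) k. of_int (cartan D k l) * c l)"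
proof -
  have *: "height Q l < height Q k" if "l \<in> later w k" "adjacent D k l" for k l
    using adapted_iff_later[OF Q(1), of w] that unfolding Q(2) using w by blast
  \<comment> \<open>If a lower neighbour \<open>l\<close> preceded \<open>k\<close>, adaptedness
    read at \<open>l\<close> would put \<open>k\<close> below \<open>l\<close>.\<close>
  have "lower (height Q) k \<subseteq> later w k"
  proof
    fix l assume l: "l \<in> lower (height Q) k"
    then have adj: "adjacent D k l" "adjacent D l k" and less: "height Q l < height Q k"
      using adjacent_sym by (auto simp: lower_def)
    have "k \<noteq> l" "l \<in> set w" using adj w by (auto simp: adjacent_def)
    then have "l \<in> later w k \<or> k \<in> later w l" using later_total k w(2) by metis
    moreover have "k \<notin> later w l" using *[OF _ adj(2)] less by auto
    ultimately show "l \<in> later w k" by blast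
  qed
  moreover have "cartan D k l = 0" if "l \<in> later w k - lower (height Q) k" for l
  proof (rule ccontr)
    assume "cartan D k l \<noteq> 0"
    moreover have "k \<noteq> l" using that w(1) by (auto simp: later_def)
    ultimately have "adjacent D k l"
      using that k w(2) later_subset[of w k] by (auto simp: adjacent_def)
    then show False using that *[of l k] by (auto simp: lower_def)
  qed
  moreover have "finite (later w k)" by (rule finite_subset[OF later_subset]) simp
  ultimately have "(\<Sum>l\<in>lower (height Q) k. of_int (cartan D k l) * c l) =
      (\<Sum>l\<in>later w k. of_int (cartan D k l) * c l)"
    by (intro sum.mono_neutral_left) auto
  then show ?thesis
    using coroot_pairing_weyl_word[of w k v] w k by (simp add: c_def)
qed

text \<open>The displacements of \<open>v\<close> under both words solve one system, whose
  right-hand sides are the pairings of \<open>v\<close>.\<close>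

lemma adapted_weyl_word_eq:
  assumes Q: "dynkin_quiver Q" "diagram Q = D"
    and w: "distinct w" "set w = verts D" "adapted Q w"
    and u: "distinct u" "set u = verts D" "adapted Q u"
  shows "weyl_word D w = weyl_word D u"
proof (intro ext)
  fix v k
  show "weyl_word D w v k = weyl_word D u v k"
  proof (cases "k \<in> verts D")
    case True
    have "v k - weyl_word D w v k = v k - weyl_word D u v k"
      by (rule lower_system_unique[OF _ True, where h = "height Q"])
        (simp flip: coroot_pairing_adapted[OF Q w] coroot_pairing_adapted[OF Q u])
    then show ?thesis by simp
  next
    case False
    then show ?thesis using w u by (simp add: weyl_word_notin)
  qed
qed

lemma adapted_of_weyl_word_eq:
  assumes Q: "dynkin_quiver Q" "diagram Q = D"
    and w: "distinct w" "set w = verts D" "adapted Q w"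
    and u: "distinct u" "set u = verts D" and eq: "weyl_word D u = weyl_word D w"
  shows "adapted Q u"
proof -
  have later: "height Q l < height Q k" if l: "l \<in> later u k" and adj: "adjacent D k l" for k l
  proof -
    have kl: "k \<in> verts D" "l \<in> verts D" "k \<noteq> l" "cartan D k l \<noteq> 0"
      using adj by (auto simp: adjacent_def)
    have fin: "finite (later u k)" "finite (lower (height Q) k)" for k
      using later_subset[of u k] lower_subset[of "height Q" k] finite_verts
      by (auto intro: finite_subset)
    \<comment> \<open>The test vector is chosen so that, by uniqueness of solutions, its
      displacement under \<open>w\<close> is \<open>simple_root l\<close> on the vertices.\<close>
    obtain v where v: "\<And>m. m \<in> verts D \<Longrightarrow> coroot_pairing D m v =
        simple_root l m +
        (\<Sum>a\<in>lower (height Q) m. of_int (cartan D m a) * simple_root l a)"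
      using ex_coroot_pairing[of "\<lambda>m. simple_root l m +
        (\<Sum>a\<in>lower (height Q) m. of_int (cartan D m a) * simple_root l a)"] by auto
    have c: "v m - weyl_word D w v m = simple_root l m" if "m \<in> verts D" for m
      by (rule lower_system_unique[OF _ that, where h = "height Q"])
        (simp flip: coroot_pairing_adapted[OF Q w] add: v)
    \<comment> \<open>The same displacement is now read along \<open>u\<close>, where
      \<open>l\<close> follows \<open>k\<close>; the row yields the nonzero entry
      \<open>cartan D k l\<close>. Compared with the prescribed row of \<open>v\<close>, this forces
      \<open>l\<close> into \<open>lower (height Q) k\<close>.\<close>
    have "coroot_pairing D k v = simple_root l k +
        (\<Sum>a\<in>later u k. of_int (cartan D k a) * (v a - weyl_word D w v a))"
      using coroot_pairing_weyl_word[of u k v] u kl c by (simp add: eq)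
    also have "\<dots> = (\<Sum>a\<in>later u k. of_int (cartan D k a) * simple_root l a)"
      using kl c later_subset[of u k] u by (auto simp: simple_root_def intro!: sum.cong)
    also have "\<dots> = of_int (cartan D k l)"
      using l fin by (simp add: simple_root_def if_distrib cong: if_cong)
    finally have "(\<Sum>a\<in>lower (height Q) k. of_int (cartan D k a) * simple_root l a) \<noteq> 0"
      using v[OF kl(1)] kl by (simp add: simple_root_def)
    then obtain a where "a \<in> lower (height Q) k" "simple_root l a \<noteq> 0"
      by (metis (no_types, lifting) mult_zero_right sum.neutral)
    then show ?thesis by (auto simp: lower_def simple_root_def split: if_splits)
  qed
  show ?thesis
    using adapted_iff_later[OF Q(1), of u] unfolding Q(2) using u later by blast
qed

lemma tau_eq_weyl_word:
  assumes Q: "dynkin_quiver Q" "diagram Q = D"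
    and w: "distinct w" "set w = verts D"
    and sorted: "sorted_wrt (\<lambda>k l. height Q l \<le> height Q k) w"
  shows "tau Q = weyl_word D w"
proof -
  \<comment> \<open>Adjacent heights are never equal, so the weak sorting is strict on
    neighbours.\<close>
  have "height Q l < height Q k" if "l \<in> later w k" "adjacent D k l" for k l
    using later_sorted_wrt[OF sorted that(1)] that(2) Q by (fastforce simp: dynkin_quiver_def)
  then have ad: "adapted Q w"
    using adapted_iff_later[OF Q(1), of w] unfolding Q(2) using w by blast
  show ?thesis
    unfolding tau_def Q(2)
  proof (rule the_equality)
    show "coxeter_element D (weyl_word D w) \<and>
        (\<forall>u. reduced_word D u \<and> weyl_word D u = weyl_word D w \<longrightarrow> adapted Q u)"
      using adapted_of_weyl_word_eq[OF Q w ad] coxeter_reduced_word[OF w] w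
      unfolding coxeter_element_def by blast
  next
    \<comment> \<open>A defining word of a competitor is itself reduced, hence adapted by the
      property assumed of \<open>x\<close>.\<close>
    fix x assume x: "coxeter_element D x \<and>
        (\<forall>u. reduced_word D u \<and> weyl_word D u = x \<longrightarrow> adapted Q u)"
    then obtain u where u: "distinct u" "set u = verts D" "x = weyl_word D u"
      unfolding coxeter_element_def by auto
    then have "adapted Q u" using x reduced_word_coxeter by auto
    then show "x = weyl_word D w"
      using adapted_weyl_word_eq[OF Q w ad u(1,2)] u(3) by simp
  qed
qed

end

section \<open>Types A and C\<close>

lemma verts_type_A [simp]: "verts (type_A m) = {1..m}"
  by (simp add: type_A_def)

lemma verts_type_C [simp]: "verts (type_C n) = {1..n}"
  by (simp add: type_C_def)

lemma coroot_pairing_type_A: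
  assumes "i \<in> {1..m}"
  shows "coroot_pairing (type_A m) i v =
    2 * v i - (if 1 < i then v (i - 1) else 0) - (if i < m then v (i + 1) else 0)"
proof -
  have "coroot_pairing (type_A m) i v =
      (\<Sum>j\<in>{1..m}. (if j = i then 2 * v j else 0) - (if j = i - 1 then v j else 0)
        - (if j = i + 1 then v j else 0))"
    unfolding coroot_pairing_def using assms
    by (intro sum.cong) (auto simp: type_A_def)
  then show ?thesis
    using assms by (auto simp: sum_subtractf)
qed

lemma coroot_pairing_type_C:
  assumes "i \<in> {1..n}"
  shows "coroot_pairing (type_C n) i v =
    2 * v i - (if 1 < i then v (i - 1) else 0)
    - (if i < n then (if i + 1 = n then 2 else 1) * v (i + 1) else 0)"
proof -
  have "coroot_pairing (type_C n) i v =
      (\<Sum>j\<in>{1..n}. (if j = i then 2 * v j else 0) - (if j = i - 1 then v j else 0)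
        - (if j = i + 1 then (if j = n then 2 else 1) * v j else 0))"
    unfolding coroot_pairing_def using assms
    by (intro sum.cong) (auto simp: type_C_def)
  then show ?thesis
    using assms by (auto simp: sum_subtractf)
qed

section \<open>The folding map on coefficients and pairings\<close>

lemma fold_vertex_fibre:
  "i \<in> {1..n} \<Longrightarrow>
    {j \<in> {1..2 * n - 1}. fold_vertex n j = i} = (if i = n then {n} else {i, 2 * n - i})"
  by (auto simp: fold_vertex_def split: if_splits)

lemma psi_apply:
  assumes "1 \<le> n"
  shows "psi n v i =
    (if 1 \<le> i \<and> i < n then v i + v (2 * n - i) else if i = n then v n else 0)"
proof -
  have "psi n v i = (\<Sum>j\<in>{1..2 * n - 1}. if fold_vertex n j = i then v j else 0)"
    unfolding psi_def simple_root_def by (intro sum.cong) auto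
  also have "\<dots> = (\<Sum>j\<in>{j \<in> {1..2 * n - 1}. fold_vertex n j = i}. v j)"
    by (rule sum.inter_filter[symmetric]) simp
  also have "{j \<in> {1..2 * n - 1}. fold_vertex n j = i} =
      (if 1 \<le> i \<and> i < n then {i, 2 * n - i} else if i = n then {n} else {})"
  proof (cases "i \<in> {1..n}")
    case True
    then show ?thesis unfolding fold_vertex_fibre[OF True] by auto
  next
    case False
    then show ?thesis using assms by (auto simp: fold_vertex_def)
  qed
  finally show ?thesis by auto
qed

text \<open>The transpose of \<open>psi\<close> sends each coroot of type C to the sum of the type A
  coroots over the folding orbit.\<close>

lemma coroot_pairing_psi:
  assumes "i \<in> {1..n}"
  shows "coroot_pairing (type_C n) i (psi n v) =
    (if i = n then coroot_pairing (type_A (2 * n - 1)) n v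
     else coroot_pairing (type_A (2 * n - 1)) i v + coroot_pairing (type_A (2 * n - 1)) (2 * n - i) v)"
proof -
  have n: "1 \<le> n" using assms by auto
  consider "i = n" | "i + 1 = n" | "i + 1 < n" using assms by fastforce
  then show ?thesis
  proof cases
    case 1
    then show ?thesis using n
      by (auto simp: coroot_pairing_type_A coroot_pairing_type_C psi_apply)
  next
    \<comment> \<open>Both orbit members, \<open>n - 1\<close> and \<open>n + 1\<close>, are
      adjacent to the middle vertex; this produces the Cartan entry -2.\<close>
    case 2
    then have "2 * n - i = n + 1" "2 * n - (i - 1) = n + 2" "2 * n - 1 = n + i" "n = i + 1"
      using assms by auto
    then show ?thesis using assms
      by (cases "i = 1") (auto simp: coroot_pairing_type_A coroot_pairing_type_C psi_apply
          eval_nat_numeral)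
  next
    case 3
    define l where "l = 2 * n - i"
    have "2 * n - i = l" "2 * n - (i - 1) = l + 1" "2 * n - (i + 1) = l - 1" "i < n" "n < l"
      "l \<le> 2 * n - 1" "1 < i \<longleftrightarrow> l < 2 * n - 1" "i - 1 < n" "i - 1 \<noteq> n"
      using 3 assms by (auto simp: l_def)
    then show ?thesis using 3 assms
      by (cases "i = 1") (auto simp: coroot_pairing_type_A coroot_pairing_type_C psi_apply)
  qed
qed

lemma psi_diff: "psi n (\<lambda>j. u j - v j) = (\<lambda>j. psi n u j - psi n v j)"
  by (simp add: psi_def fun_eq_iff algebra_simps sum_subtractf)

lemma psi_in_root_space: "1 \<le> n \<Longrightarrow> psi n v \<in> root_space (type_C n)"
  by (auto simp: root_space_def type_C_def psi_apply)

text \<open>Phrased for any vector with the right pairings, to serve both the construction of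
  fundamental weights in type C and the comparison with those of type A.\<close>

lemma psi_fund_weight_pairing:
  assumes "1 \<le> i" "i \<le> n" "a = i \<or> a = 2 * n - i" "j \<in> {1..n}"
    and "\<And>j. j \<in> {1..2 * n - 1} \<Longrightarrow>
      coroot_pairing (type_A (2 * n - 1)) j v = (if j = a then 1 else 0)"
  shows "coroot_pairing (type_C n) j (psi n v) = (if j = i then 1 else 0)"
proof -
  have "j \<in> {1..2 * n - 1}" "2 * n - j \<in> {1..2 * n - 1}" using assms(4) by auto
  note pairing = assms(5)[OF this(1)] assms(5)[OF this(2)]
  show ?thesis
  proof (cases "j = n")
    case True
    then show ?thesis using assms(1-4) pairing by (auto simp: coroot_pairing_psi)
  next
    case False
    \<comment> \<open>Of the two pairings being added, exactly one is 1 if \<open>j = i\<close>, and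
      none otherwise.\<close>
    then have "(j = a \<or> 2 * n - j = a) \<longleftrightarrow> j = i" "\<not> (j = a \<and> 2 * n - j = a)"
      using assms(1-4) by auto
    then show ?thesis using assms(4) False pairing
      by (auto simp: coroot_pairing_psi)
  qed
qed

section \<open>Invertibility of the Cartan matrices\<close>

lemma type_A_kernel:
  assumes "v \<in> root_space (type_A m)"
    and "\<And>j. j \<in> {1..m} \<Longrightarrow> coroot_pairing (type_A m) j v = 0"
  shows "v = (\<lambda>_. 0)"
proof -
  have out: "v j = 0" if "j \<notin> {1..m}" for j
    using assms(1) that by (auto simp: root_space_def type_A_def)
  \<comment> \<open>Second differences vanish, so \<open>v\<close> is linear; it is zero at the
    outer points 0 and \<open>m + 1\<close>, hence everywhere.\<close>
  have rec: "v (j + 1) = 2 * v j - v (j - 1)" if "j \<in> {1..m}" for j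
    using assms(2)[OF that] that out[of 0] out[of "m + 1"]
    by (auto simp: coroot_pairing_type_A not_less le_Suc_eq split: if_splits)
  have lin: "j \<le> m + 1 \<Longrightarrow> v j = of_nat j * v 1" for j
  proof (induction j rule: less_induct)
    case (less j)
    show ?case
    proof (cases "j \<le> 1")
      case True
      then show ?thesis using out[of 0] by (auto simp: le_Suc_eq)
    next
      case False
      then obtain l where "j = l + 2" using le_Suc_ex[of 2 j] by auto
      then show ?thesis using less.IH[of l] less.IH[of "l + 1"] less.prems rec[of "l + 1"]
        by (simp add: algebra_simps)
    qed
  qed
  have "of_nat (m + 1) * v 1 = 0" using lin[of "m + 1"] out[of "m + 1"] by simp
  then have "v 1 = 0" by (simp del: of_nat_Suc of_nat_add)
  show ?thesis
  proof
    fix j show "v j = 0"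
      using lin[of j] out[of j] \<open>v 1 = 0\<close> by (cases "j \<le> m + 1") simp_all
  qed
qed

lemma type_C_kernel:
  assumes "v \<in> root_space (type_C n)"
    and "\<And>j. j \<in> {1..n} \<Longrightarrow> coroot_pairing (type_C n) j v = 0"
  shows "v = (\<lambda>_. 0)"
proof -
  have out: "v j = 0" if "j \<notin> {1..n}" for j
    using assms(1) that by (auto simp: root_space_def type_C_def)
  have rec: "v (j + 1) = 2 * v j - v (j - 1)" if "1 \<le> j" "j + 1 < n" for j
    using assms(2)[of j] that out[of 0]
    by (auto simp: coroot_pairing_type_C split: if_splits)
  have lin: "j < n \<Longrightarrow> v j = of_nat j * v 1" for j
  proof (induction j rule: less_induct)
    case (less j)
    show ?case
    proof (cases "j \<le> 1")
      case True
      then show ?thesis using out[of 0] by (auto simp: le_Suc_eq)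
    next
      case False
      then obtain l where "j = l + 2" using le_Suc_ex[of 2 j] by auto
      then show ?thesis using less.IH[of l] less.IH[of "l + 1"] less.prems rec[of "l + 1"]
        by (simp add: algebra_simps)
    qed
  qed
  have "v j = 0" if j: "j \<in> {1..n}" for j
  proof -
    show ?thesis
    proof (cases "n = 1")
      case True
      then show ?thesis using assms(2)[of 1] j by (simp add: coroot_pairing_type_C)
    next
      case False
      then obtain l where n: "n = l + 2" using j le_Suc_ex[of 2 n] by auto
      \<comment> \<open>The recursion reaches only \<open>n - 1\<close>; inserting the last row into
        this one gives \<open>v (l + 1) = v l\<close>, so the slope \<open>v 1\<close> is
        zero.\<close>
      have "2 * v (l + 1) - v l - 2 * v (l + 2) = 0"
        using assms(2)[of "l + 1"] n out[of 0]
        by (cases "l = 0") (simp_all add: coroot_pairing_type_C)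
      moreover have "2 * v (l + 2) = v (l + 1)"
        using assms(2)[of "l + 2"] n by (simp add: coroot_pairing_type_C)
      moreover have "v l = of_nat l * v 1" "v (l + 1) = of_nat l * v 1 + v 1"
        using lin[of l] lin[of "l + 1"] n by (simp_all add: algebra_simps)
      ultimately have "v 1 = 0" "v n = 0" using n by simp_all
      then show ?thesis using lin[of j] j by (cases "j = n") auto
    qed
  qed
  then show ?thesis using out by (intro ext) metis
qed

lemma ex1_fund_weightI:
  assumes "v \<in> root_space D"
    and "\<And>j. j \<in> verts D \<Longrightarrow> coroot_pairing D j v = (if j = i then 1 else 0)"
    and kernel: "\<And>u. u \<in> root_space D \<Longrightarrow> (\<And>j. j \<in> verts D \<Longrightarrow> coroot_pairing D j u = 0) \<Longrightarrow>
      u = (\<lambda>_. 0)"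
  shows "\<exists>!v. v \<in> root_space D \<and>
    (\<forall>j\<in>verts D. coroot_pairing D j v = (if j = i then 1 else 0))"
proof (rule ex1I[of _ v])
  fix u assume u: "u \<in> root_space D \<and>
    (\<forall>j\<in>verts D. coroot_pairing D j u = (if j = i then 1 else 0))"
  have "(\<lambda>j. u j - v j) = (\<lambda>_. 0)"
    using u assms(1,2) by (intro kernel) (auto simp: root_space_def coroot_pairing_diff)
  then show "u = v" by (simp add: fun_eq_iff)
qed (use assms in auto)

lemma type_A_ex1_fund_weight:
  assumes i: "i \<in> {1..m}"
  shows "\<exists>!v. v \<in> root_space (type_A m) \<and>
    (\<forall>j\<in>verts (type_A m). coroot_pairing (type_A m) j v = (if j = i then 1 else 0))"
proof -
  define q :: rat where "q = of_nat i / of_nat (m + 1)"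
  \<comment> \<open>Minus the second difference of \<open>min i j\<close> in \<open>j\<close> is the
    delta at \<open>i\<close>; the linear term restores the value 0 at \<open>m + 1\<close> without
    changing it.\<close>
  define v :: vec where "v = (\<lambda>j. if j \<in> {1..m} then of_nat (min i j) - q * of_nat j else 0)"
  have q: "q * of_nat (m + 1) = of_nat i"
    unfolding q_def by (simp del: of_nat_Suc of_nat_add)
  \<comment> \<open>The formula also holds at 0 and \<open>m + 1\<close>, which spares boundary
    cases for the pairings.\<close>
  have v: "v j = of_nat (min i j) - q * of_nat j" if "j \<le> m + 1" for j
  proof -
    consider "j = 0" | "j \<in> {1..m}" | "j = m + 1" using \<open>j \<le> m + 1\<close> by fastforce
    then show ?thesis
    proof cases
      case 3
      then show ?thesis using i q by (simp add: v_def min_def)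
    qed (simp_all add: v_def)
  qed
  have pairing: "coroot_pairing (type_A m) j v = (if j = i then 1 else 0)" if j: "j \<in> {1..m}" for j
  proof -
    obtain l where l: "j = Suc l" using j by (cases j) auto
    have "coroot_pairing (type_A m) j v = 2 * v j - v (j - 1) - v (j + 1)"
      using j by (auto simp: coroot_pairing_type_A v_def)
    also have "\<dots> = 2 * of_nat (min i j) - of_nat (min i (j - 1)) - of_nat (min i (j + 1))"
      using j l by (simp add: v algebra_simps)
    also have "\<dots> = (if j = i then 1 else 0)"
      using l i by (auto simp: min_def le_Suc_eq)
    finally show ?thesis .
  qed
  show ?thesis
    by (rule ex1_fund_weightI[of v])
      (use pairing type_A_kernel[of _ m] in \<open>auto simp: root_space_def v_def\<close>)
qed

lemma finite_type_A: "finite_type (type_A m)"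
proof
  fix i assume "i \<in> verts (type_A m)"
  then show "\<exists>!v. v \<in> root_space (type_A m) \<and>
      (\<forall>j\<in>verts (type_A m). coroot_pairing (type_A m) j v = (if j = i then 1 else 0))"
    by (intro type_A_ex1_fund_weight) simp
qed (auto simp: type_A_def adjacent_def split: if_splits)

lemma finite_type_C: "finite_type (type_C n)"
proof
  fix i assume "i \<in> verts (type_C n)"
  then have i: "1 \<le> i" "i \<le> n" by auto
  then have "i \<in> {1..2 * n - 1}" by auto
  \<comment> \<open>Fundamental weights of type C are obtained by folding those of type A.\<close>
  then obtain v where "\<forall>j\<in>{1..2 * n - 1}.
      coroot_pairing (type_A (2 * n - 1)) j v = (if j = i then 1 else 0)"
    using type_A_ex1_fund_weight[of i "2 * n - 1"] unfolding verts_type_A by blast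
  then have "coroot_pairing (type_C n) j (psi n v) = (if j = i then 1 else 0)"
    if "j \<in> {1..n}" for j
    using i that by (intro psi_fund_weight_pairing[where a = i]) auto
  then show "\<exists>!v. v \<in> root_space (type_C n) \<and>
      (\<forall>j\<in>verts (type_C n). coroot_pairing (type_C n) j v = (if j = i then 1 else 0))"
    using i psi_in_root_space[of n v] type_C_kernel[of _ n]
    by (intro ex1_fund_weightI[of "psi n v"]) auto
qed (auto simp: type_C_def adjacent_def split: if_splits)

lemma psi_fund_weight:
  assumes i: "1 \<le> i" "i \<le> n" and a: "a = i \<or> a = 2 * n - i"
  shows "psi n (fund_weight (type_A (2 * n - 1)) a) = fund_weight (type_C n) i"
proof -
  interpret A: finite_type "type_A (2 * n - 1)" by (rule finite_type_A)
  interpret C: finite_type "type_C n" by (rule finite_type_C)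
  let ?v = "fund_weight (type_A (2 * n - 1)) a"
  have "a \<in> verts (type_A (2 * n - 1))" using i a by auto
  note A.fund_weight(2)[OF this, unfolded verts_type_A]
  then have "coroot_pairing (type_C n) j (psi n ?v) = (if j = i then 1 else 0)"
    if "j \<in> {1..n}" for j
    using i a that by (intro psi_fund_weight_pairing)
  then show ?thesis
    using i by (intro C.fund_weight_eqI[symmetric] psi_in_root_space) auto
qed

section \<open>Folding\<close>

text \<open>Each letter is replaced by its folding orbit; for \<open>1 \<le> i < n\<close> the two
  letters are not adjacent, so their reflections commute.\<close>

definition unfold_word :: "nat \<Rightarrow> nat list \<Rightarrow> nat list" where
  "unfold_word n w = concat (map (\<lambda>i. if i = n then [n] else [i, 2 * n - i]) w)"

lemma unfold_word_simps [simp]: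
  "unfold_word n [] = []"
  "unfold_word n (i # w) = (if i = n then n # unfold_word n w else i # (2 * n - i) # unfold_word n w)"
  by (simp_all add: unfold_word_def)

lemma psi_reflection:
  assumes "1 \<le> n"
  shows "psi n (reflection (type_A (2 * n - 1)) n v) = reflection (type_C n) n (psi n v)"
    and "1 \<le> i \<Longrightarrow> i < n \<Longrightarrow>
      psi n (reflection (type_A (2 * n - 1)) i (reflection (type_A (2 * n - 1)) (2 * n - i) v)) =
      reflection (type_C n) i (psi n v)"
proof -
  show "psi n (reflection (type_A (2 * n - 1)) n v) = reflection (type_C n) n (psi n v)"
  proof
    fix j
    show "psi n (reflection (type_A (2 * n - 1)) n v) j = reflection (type_C n) n (psi n v) j"
      using assms coroot_pairing_psi[of n n v]
      by (auto simp: psi_apply reflection_def simple_root_def)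
  qed
next
  assume i: "1 \<le> i" "i < n"
  let ?A = "type_A (2 * n - 1)"
  let ?u = "reflection ?A (2 * n - i) v"
  \<comment> \<open>Since \<open>i\<close> and \<open>2 * n - i\<close> are not adjacent, the
    reflections subtract their pairings independently, and \<open>psi\<close> adds the two.\<close>
  have orth: "coroot_pairing ?A i ?u = coroot_pairing ?A i v"
    using i by (simp add: coroot_pairing_type_A reflection_other)
  show "psi n (reflection ?A i ?u) = reflection (type_C n) i (psi n v)"
  proof
    fix j
    show "psi n (reflection ?A i ?u) j = reflection (type_C n) i (psi n v) j"
      using assms i coroot_pairing_psi[of i n v]
      unfolding reflection_def[of ?A i] orth
      by (auto simp: psi_apply reflection_def simple_root_def)
  qed
qed

lemma psi_unfold_word:
  assumes "set w \<subseteq> {1..n}"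
  shows "psi n (weyl_word (type_A (2 * n - 1)) (unfold_word n w) v) = weyl_word (type_C n) w (psi n v)"
  using assms
proof (induction w)
  case Nil
  then show ?case by simp
next
  case (Cons i w)
  then have i: "1 \<le> i" "i \<le> n" "1 \<le> n" by auto
  have "psi n (weyl_word (type_A (2 * n - 1)) (unfold_word n (i # w)) v) =
      reflection (type_C n) i (psi n (weyl_word (type_A (2 * n - 1)) (unfold_word n w) v))"
    using i psi_reflection(1)[OF i(3)] psi_reflection(2)[OF i(3), of i]
    by (cases "i = n") auto
  then show ?case using Cons by simp
qed

lemma set_unfold_word:
  "set w \<subseteq> {1..n} \<Longrightarrow> set (unfold_word n w) = {j \<in> {1..2 * n - 1}. fold_vertex n j \<in> set w}"
proof (induction w)
  case (Cons i w)
  then have "i \<in> {1..n}" by simp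
  from fold_vertex_fibre[OF this] have "set (unfold_word n (i # w)) =
      {j \<in> {1..2 * n - 1}. fold_vertex n j = i} \<union> set (unfold_word n w)"
    by auto
  then show ?case using Cons by auto
qed simp

lemma fold_vertex_orbit:
  "i \<le> n \<Longrightarrow> fold_vertex n i = i" "i \<le> n \<Longrightarrow> fold_vertex n (2 * n - i) = i"
  by (auto simp: fold_vertex_def)

lemma distinct_unfold_word:
  "distinct w \<Longrightarrow> set w \<subseteq> {1..n} \<Longrightarrow> distinct (unfold_word n w)"
  by (induction w) (auto simp: set_unfold_word fold_vertex_orbit)

text \<open>Reflexivity of \<open>P\<close> handles the two letters of one orbit, which fold to the
  same vertex.\<close>

lemma sorted_wrt_unfold_word:
  assumes "sorted_wrt P w" "set w \<subseteq> {1..n}" "\<And>i. P i i"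
  shows "sorted_wrt (\<lambda>k l. P (fold_vertex n k) (fold_vertex n l)) (unfold_word n w)"
  using assms(1,2)
proof (induction w)
  case (Cons i w)
  then have "\<And>l. l \<in> set (unfold_word n w) \<Longrightarrow> P i (fold_vertex n l)"
    by (auto simp: set_unfold_word)
  then show ?case using Cons assms(3) by (auto simp: fold_vertex_orbit)
qed simp

section \<open>Integer powers and the conclusion\<close>

lemma int_iterate_semiconj:
  assumes "bij f" "bij g" and semi: "\<And>x. h (f x) = g (h x)"
  shows "h (int_iterate f k x) = int_iterate g k (h x)"
proof -
  have pow: "h ((f' ^^ m) x) = (g' ^^ m) (h x)" if "\<And>x. h (f' x) = g' (h x)" for f' g' m
    by (induction m) (auto simp: that)
  \<comment> \<open>Bijectivity carries the intertwining over to the inverses, which covers negative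
    exponents.\<close>
  have "h (inv f x) = inv g (h x)" for x
    by (metis assms bij_inv_eq_iff)
  then show ?thesis using pow[of f g] pow[of "inv f" "inv g"] semi
    by (simp add: int_iterate_def)
qed

theorem theorem5p17:
  fixes n i :: nat and k :: int and \<xi> \<xi>' :: "nat \<Rightarrow> int" and Q Qbar :: quiver
  assumes "Q = \<lparr>diagram = type_A (2 * n - 1), height = \<xi>\<rparr>"
    and "dynkin_quiver Q"
    and "\<forall>j\<in>{1..2 * n - 1}. \<xi> j = \<xi> (2 * n - j)"
    and "Qbar = \<lparr>diagram = type_C n, height = \<xi>'\<rparr>"
    and "\<forall>j\<in>{1..n}. \<xi>' j = \<xi> j"
    and "1 \<le> i" and "i \<le> n"
  shows "psi n (int_iterate (tau Q) k (gamma Q i)) = int_iterate (tau Qbar) k (gamma Qbar i)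
       \<and> psi n (int_iterate (tau Q) k (gamma Q (2 * n - i))) = int_iterate (tau Qbar) k (gamma Qbar i)"
proof -
  interpret A: finite_type "type_A (2 * n - 1)" by (rule finite_type_A)
  interpret C: finite_type "type_C n" by (rule finite_type_C)
  \<comment> \<open>Edges of type C are edges of type A on the first \<open>n\<close> vertices, so
    \<open>Qbar\<close> inherits the height condition.\<close>
  have "adjacent (type_A (2 * n - 1)) a b" "a \<in> {1..n}" "b \<in> {1..n}"
    if "adjacent (type_C n) a b" for a b
    using that by (auto simp: adjacent_def type_A_def type_C_def split: if_splits)
  then have Qbar: "dynkin_quiver Qbar"
    using assms(2,5) unfolding assms(1,4) dynkin_quiver_def by simp
  \<comment> \<open>The negated key sorts by decreasing height.\<close>
  define w where "w = sort_key (\<lambda>j. - \<xi>' j) [1..<Suc n]"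
  let ?u = "unfold_word n w"
  have w: "distinct w" "set w = {1..n}" by (auto simp: w_def)
  have sorted: "sorted_wrt (\<lambda>k l. \<xi>' l \<le> \<xi>' k) w"
    using sorted_sort_key[of "\<lambda>j. - \<xi>' j" "[1..<Suc n]"] by (simp add: w_def sorted_map)
  have u: "distinct ?u" "set ?u = {1..2 * n - 1}"
    using w distinct_unfold_word[of w n] by (auto simp: set_unfold_word fold_vertex_def)
  have \<xi>: "\<xi>' (fold_vertex n j) = \<xi> j" if "j \<in> {1..2 * n - 1}" for j
  proof -
    have "fold_vertex n j \<in> {1..n}" using that by (auto simp: fold_vertex_def)
    then have "\<xi>' (fold_vertex n j) = \<xi> (fold_vertex n j)" using assms(5) by blast
    also have "\<dots> = \<xi> j" using bspec[OF assms(3) that] by (simp add: fold_vertex_def)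
    finally show ?thesis .
  qed
  \<comment> \<open>Symmetry of \<xi> makes heights constant on orbits, so unfolding keeps the word
    sorted and both \<open>tau\<close> are products over matching words.\<close>
  have "sorted_wrt (\<lambda>k l. \<xi> l \<le> \<xi> k) ?u"
    using sorted_wrt_unfold_word[OF sorted, of n] w u(2) \<xi>
    by (auto intro: sorted_wrt_mono_rel[rotated])
  then have tau: "tau Q = weyl_word (type_A (2 * n - 1)) ?u"
    using assms(1,2) u by (intro A.tau_eq_weyl_word) auto
  have tau': "tau Qbar = weyl_word (type_C n) w"
    using assms(4) Qbar w sorted by (intro C.tau_eq_weyl_word) auto
  have semi: "psi n (tau Q v) = tau Qbar (psi n v)" for v
    unfolding tau tau' by (rule psi_unfold_word) (simp add: w)
  have bij: "bij (tau Q)" "bij (tau Qbar)"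
    unfolding tau tau' using w u by (intro A.bij_weyl_word C.bij_weyl_word; simp)+
  have "psi n (gamma Q a) = gamma Qbar i" if "a = i \<or> a = 2 * n - i" for a
  proof -
    have "diagram Q = type_A (2 * n - 1)" "diagram Qbar = type_C n"
      using assms(1,4) by simp_all
    then show ?thesis
      unfolding gamma_def psi_diff semi using psi_fund_weight[OF assms(6,7) that] by simp
  qed
  then show ?thesis
    using int_iterate_semiconj[OF bij, of "psi n"] semi by simp
qed

end
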